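(* There exist universal constants $\beta\ge1$ and $\gamma_7,\gamma_8,\gamma_9\in(0,+\infty)$ such that the following holds. Let $\alpha\in[0,1)$. Let $\kappa_n$, $n=1,2,\ldots$, be independent $0$-$1$ random variables with $\mathbb{P}(\kappa_n=0)=1-\mathbb{P}(\kappa_n=1)=\alpha$, and let $\theta_n$, $n=1,2,\ldots$, be independent exponential random variables with expectation $1$, the two families being independent of each other. Let $a_1\ge a_2\ge a_3\ge\ldots$ be non-negative reals with $\sum_{n\ge1}a_n<+\infty$ and let $t>0$. For $n=1,2,\ldots$ let $p_n(t)$ be defined by the equality $$t=p_n(t)\cdot a_n+(1-\alpha)\sum_{k>n}a_k$$ if $a_n>0$, and $p_n(t)=+\infty$ if $a_n=0$. Then $$\mathbb{P}\left(\sum_{n\ge1}a_n\kappa_n\theta_n\ge\gamma_7\,t\right)\le(1-\alpha)\left\{\sum_{n:\,p_n(t)<2}\alpha^{n-1}+\sum_{n:\,p_n(t)\ge2}\alpha^{n-1}e^{-\beta p_n(t)}\right\}$$ and $$\mathbb{P}\left(\sum_{n\ge1}a_n\kappa_n\theta_n\ge\gamma_8\,t\right)\ge\gamma_9(1-\alpha)\left\{\sum_{n:\,p_n(t)<2}\alpha^{n-1}+\sum_{n:\,p_n(t)\ge2}\alpha^{n-1}e^{-\beta p_n(t)}\right\}.$$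
   Context: "Universal constants" means absolute numerical constants, independent of $\alpha$, $t$ and the sequence $(a_n)$. Conventions: $e^{-\infty}=0$ and $0^0=1$ (the latter relevant for $\alpha^{n-1}$ when $\alpha=0$, $n=1$). The numbers $p_n(t)$ may be negative. *)

theory Defs
  imports "HOL-Probability.Probability"
begin

text \<open>All sequences are indexed from 0: the index \<open>n\<close> here is the index \<open>n + 1\<close> of the
  one-based formulation, so that \<open>\<alpha>\<^bsup>n-1\<^esup>\<close> becomes \<open>\<alpha> ^ n\<close> (with \<open>0 ^ 0 = 1\<close>).\<close>

text \<open>Since \<open>\<P>(\<kappa>\<^sub>n = 0) + \<P>(\<kappa>\<^sub>n = 1) = 1\<close>, each \<open>\<kappa>\<^sub>n\<close> is
  0-1 valued almost surely.\<close>

locale bernoulli_exponential = prob_space M for M :: "'w measure" +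
  fixes \<alpha> :: real and \<kappa> \<theta> :: "nat \<Rightarrow> 'w \<Rightarrow> real"
  assumes indep_\<kappa>: "indep_vars (\<lambda>_. borel) \<kappa> UNIV"
    and indep_\<theta>: "indep_vars (\<lambda>_. borel) \<theta> UNIV"
    and indep_\<kappa>_\<theta>: "indep_var (Pi\<^sub>M UNIV (\<lambda>_. borel)) (\<lambda>\<omega> n. \<kappa> n \<omega>)
                            (Pi\<^sub>M UNIV (\<lambda>_. borel)) (\<lambda>\<omega> n. \<theta> n \<omega>)"
    and \<kappa>_0: "prob {\<omega> \<in> space M. \<kappa> n \<omega> = 0} = \<alpha>"
    and \<kappa>_1: "prob {\<omega> \<in> space M. \<kappa> n \<omega> = 1} = 1 - \<alpha>"
    and \<theta>_exponential: "distributed M lborel (\<theta> n) (exponential_density 1)"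

text \<open>For \<open>a n > 0\<close>, \<open>p_coeff \<alpha> a t n\<close> is the solution \<open>x\<close> of
  \<open>t = x * a n + (1 - \<alpha>) * (\<Sum>k>n. a k)\<close>; it may be negative.\<close>

definition p_coeff :: "real \<Rightarrow> (nat \<Rightarrow> real) \<Rightarrow> real \<Rightarrow> nat \<Rightarrow> ereal" where
  "p_coeff \<alpha> a t n =
     (if a n > 0 then ereal ((t - (1 - \<alpha>) * (\<Sum>k. a (Suc n + k))) / a n) else \<infinity>)"

text \<open>Only used for arguments below \<open>\<infinity>\<close>; the value at \<open>\<infinity>\<close> is irrelevant.\<close>

definition exp_ereal :: "ereal \<Rightarrow> real" where
  "exp_ereal x = (if x = -\<infinity> then 0 else exp (real_of_ereal x))"

definition tail_bound :: "real \<Rightarrow> real \<Rightarrow> (nat \<Rightarrow> real) \<Rightarrow> real \<Rightarrow> real" where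
  "tail_bound \<beta> \<alpha> a t =
     (1 - \<alpha>) * ((\<Sum>\<^sub>\<infinity>n\<in>{n. p_coeff \<alpha> a t n < 2}. \<alpha> ^ n)
              + (\<Sum>\<^sub>\<infinity>n\<in>{n. p_coeff \<alpha> a t n \<ge> 2}. \<alpha> ^ n * exp_ereal (ereal (- \<beta>) * p_coeff \<alpha> a t n)))"

text \<open>The series below converges almost surely, so the value of the real-valued sum on the
  divergence set does not matter. The first argument fixes the type of the sample
  points; the probability space on it is arbitrary.\<close>

definition tail_constants ::
    "'w itself \<Rightarrow> real \<Rightarrow> real \<Rightarrow> real \<Rightarrow> real \<Rightarrow> bool" where
  "tail_constants (W :: 'w itself) \<beta> \<gamma>\<^sub>7 \<gamma>\<^sub>8 \<gamma>\<^sub>9 \<longleftrightarrow>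
     \<beta> \<ge> 1 \<and> \<gamma>\<^sub>7 > 0 \<and> \<gamma>\<^sub>8 > 0 \<and> \<gamma>\<^sub>9 > 0 \<and>
     (\<forall>\<alpha> (M :: 'w measure) \<kappa> \<theta> a t.
        0 \<le> \<alpha> \<and> \<alpha> < 1 \<and> bernoulli_exponential M \<alpha> \<kappa> \<theta> \<and>
        antimono a \<and> (\<forall>n. 0 \<le> a n) \<and> summable a \<and> 0 < t \<longrightarrow>
          measure M {\<omega> \<in> space M. (\<Sum>n. a n * \<kappa> n \<omega> * \<theta> n \<omega>) \<ge> \<gamma>\<^sub>7 * t}
            \<le> tail_bound \<beta> \<alpha> a t \<and>
          measure M {\<omega> \<in> space M. (\<Sum>n. a n * \<kappa> n \<omega> * \<theta> n \<omega>) \<ge> \<gamma>\<^sub>8 * t}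
            \<ge> \<gamma>\<^sub>9 * tail_bound \<beta> \<alpha> a t)"

text \<open>HOL cannot quantify over types below an existential quantifier, so
  ``there are constants that work for all probability spaces'' is rendered as: there are
  constants that work for all probability spaces on the sequence space
  \<open>nat \<Rightarrow> real \<times> real\<close>, and any constants that work there work for all probability spaces on
  any type \<open>'w\<close>. A bare \<open>\<exists>\<close> over \<open>tail_constants TYPE('w)\<close> would let the constants depend on
  \<open>'w\<close>.\<close>

end

theory Submission
  imports Defs
begin

text \<open>The proof splits the probability space by the first index \<open>n\<close> with \<open>\<kappa> n = 1\<close>. This index equals
  \<open>n\<close> with probability \<open>(1 - \<alpha>) * \<alpha> ^ n\<close> and is independent of the variables that remain, and on this
  event the sum equals \<open>a n * \<theta> n\<close> plus the remainder \<open>later_sum a n\<close>, whose mean is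
  \<open>later_mean a n = (1 - \<alpha>) * (\<Sum>k>n. a k)\<close>. So a tail probability of the sum is exactly a series with
  the coefficients \<open>(1 - \<alpha>) * \<alpha> ^ n\<close> (\<open>first_success_decomposition\<close>), as is the bound to which it is
  compared (\<open>tail_bound_sums\<close>). It remains to show, for each \<open>n\<close>, that up to constant factors at \<open>t\<close>
  and in front, the probability of \<open>a n * \<theta> n + later_sum a n \<ge> t\<close> is \<open>1\<close> if \<open>p < 2\<close> and
  \<open>exp (- p)\<close> if \<open>p \<ge> 2\<close>, where \<open>t = p * a n + later_mean a n\<close>.

  The reason is that all later weights are at most \<open>a n\<close>, so on the scale \<open>a n\<close> the remainder has an
  exponential moment like that of a Poisson variable and behaves as its mean: it exceeds a
  multiple of \<open>t\<close> with probability at most \<open>exp (- p)\<close>, also with \<open>a n * \<theta> n\<close> added to it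
  (\<open>prob_tail_upper\<close>), and it rarely drops below a quarter of its mean, unless the mean is of the order
  of \<open>a n\<close> and hence negligible against the deviations of \<open>a n * \<theta> n\<close> (\<open>prob_tail_lower\<close>). Both come
  from one estimate of the exponential moment, \<open>nn_integral_exp_weighted_sum_le\<close>. The constants are
  \<open>\<beta> = 1\<close>, \<open>\<gamma>\<^sub>7 = 4\<close>, \<open>\<gamma>\<^sub>8 = 1 / 6\<close> and \<open>\<gamma>\<^sub>9 = exp (- 1)\<close>.

  For the second half of the theorem the model is pushed forward to the space of sequences
  (\<open>tail_constants_transfer\<close>).\<close>

section \<open>Independent families and exponential moments\<close>

text \<open>The case \<open>K = {}\<close> arises when a finite set of indices meets only one of two families.\<close>
lemma (in prob_space) prob_cylinder:
  assumes V: "indep_vars (\<lambda>_. N) V UNIV" and K: "finite K" "\<forall>i\<in>K. B i \<in> sets N"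
  shows "prob ((\<lambda>\<omega> i. V i \<omega>) -` {f \<in> space (Pi\<^sub>M UNIV (\<lambda>_. N)). \<forall>i\<in>K. f i \<in> B i} \<inter> space M)
        = (\<Prod>i\<in>K. prob (V i -` B i \<inter> space M))"
proof (cases "K = {}")
  case True
  have "(\<lambda>\<omega> i. V i \<omega>) -` space (Pi\<^sub>M UNIV (\<lambda>_. N)) \<inter> space M = space M"
    using V by (auto simp: indep_vars_def space_PiM measurable_def)
  then show ?thesis using True by (simp add: prob_space)
next
  case False
  have "(\<lambda>\<omega> i. V i \<omega>) -` {f \<in> space (Pi\<^sub>M UNIV (\<lambda>_. N)). \<forall>i\<in>K. f i \<in> B i} \<inter> space M
      = (\<Inter>i\<in>K. V i -` B i \<inter> space M)"
    using V False by (auto simp: indep_vars_def space_PiM measurable_def)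
  then show ?thesis using indep_varsD[OF V False K(1)] K(2) by simp
qed

text \<open>Two independent families, independent of each other as random sequences, form one independent
  family over the disjoint union of the index sets: a finite intersection of events splits into
  one cylinder for each sequence, and each cylinder has the product probability.\<close>
lemma (in prob_space) indep_vars_case_sum:
  fixes X :: "'i \<Rightarrow> 'a \<Rightarrow> 'b" and Y :: "'i \<Rightarrow> 'a \<Rightarrow> 'b"
  assumes X: "indep_vars (\<lambda>_. N) X UNIV" and Y: "indep_vars (\<lambda>_. N) Y UNIV"
    and XY: "indep_var (Pi\<^sub>M UNIV (\<lambda>_. N)) (\<lambda>\<omega> i. X i \<omega>) (Pi\<^sub>M UNIV (\<lambda>_. N)) (\<lambda>\<omega> j. Y j \<omega>)"
  shows "indep_vars (\<lambda>_. N) (case_sum X Y) UNIV"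
proof -
  have rvX: "random_variable N (X i)" and rvY: "random_variable N (Y j)" for i j
    using X Y by (auto simp: indep_vars_def)
  show ?thesis
    unfolding indep_vars_def2
  proof (intro conjI ballI indep_setsI)
    show "random_variable N (case_sum X Y i)" for i
      using rvX rvY by (cases i) auto
    then show "{case_sum X Y i -` A \<inter> space M |A. A \<in> sets N} \<subseteq> events" for i
      by auto
    fix E and J :: "('i + 'i) set"
    assume J: "finite J" and E: "\<forall>i\<in>J. E i \<in> {case_sum X Y i -` A \<inter> space M |A. A \<in> sets N}"
    obtain B where B: "\<forall>i\<in>J. E i = case_sum X Y i -` B i \<inter> space M \<and> B i \<in> sets N"
      using bchoice[of J "\<lambda>i A. E i = case_sum X Y i -` A \<inter> space M \<and> A \<in> sets N"] E by blast
    assume "J \<noteq> {}"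
    define J1 J2 where "J1 = Inl -` J" and "J2 = Inr -` J"
    have fin: "finite J1" "finite J2"
      using J by (auto simp: J1_def J2_def intro: finite_vimageI)
    have J_eq: "J = Inl ` J1 \<union> Inr ` J2"
      by (auto simp: J1_def J2_def image_iff) (metis sum.exhaust)
    let ?C1 = "{f \<in> space (Pi\<^sub>M UNIV (\<lambda>_. N)). \<forall>i\<in>J1. f i \<in> B (Inl i)}"
    let ?C2 = "{f \<in> space (Pi\<^sub>M UNIV (\<lambda>_. N)). \<forall>i\<in>J2. f i \<in> B (Inr i)}"
    have B1: "\<forall>i\<in>J1. B (Inl i) \<in> sets N" and B2: "\<forall>i\<in>J2. B (Inr i) \<in> sets N"
      using B by (auto simp: J1_def J2_def)
    have spX: "X i \<omega> \<in> space N" and spY: "Y j \<omega> \<in> space N" if "\<omega> \<in> space M" for i j \<omega>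
      using measurable_space[OF rvX that] measurable_space[OF rvY that] by auto
    have "(\<Inter>i\<in>J. E i) = (\<lambda>\<omega>. (\<lambda>i. X i \<omega>, \<lambda>j. Y j \<omega>)) -` (?C1 \<times> ?C2) \<inter> space M"
    proof -
      have "(\<Inter>i\<in>J. E i) = {\<omega> \<in> space M. \<forall>i\<in>J. case_sum X Y i \<omega> \<in> B i}"
        using B \<open>J \<noteq> {}\<close> by auto
      also have "\<dots> = {\<omega> \<in> space M. (\<forall>i\<in>J1. X i \<omega> \<in> B (Inl i)) \<and> (\<forall>i\<in>J2. Y i \<omega> \<in> B (Inr i))}"
        unfolding J_eq by (simp add: ball_Un)
      also have "\<dots> = (\<lambda>\<omega>. (\<lambda>i. X i \<omega>, \<lambda>j. Y j \<omega>)) -` (?C1 \<times> ?C2) \<inter> space M"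
        using spX spY by (auto simp: space_PiM)
      finally show ?thesis .
    qed
    also have "prob \<dots> = prob ((\<lambda>\<omega> i. X i \<omega>) -` ?C1 \<inter> space M) * prob ((\<lambda>\<omega> j. Y j \<omega>) -` ?C2 \<inter> space M)"
      using B1 B2 fin
      by (intro indep_varD[OF XY] sets.sets_Collect_finite_All) auto
    also have "\<dots> = (\<Prod>i\<in>J1. prob (X i -` B (Inl i) \<inter> space M)) * (\<Prod>i\<in>J2. prob (Y i -` B (Inr i) \<inter> space M))"
      by (simp only: prob_cylinder[OF X fin(1) B1] prob_cylinder[OF Y fin(2) B2])
    also have "\<dots> = (\<Prod>i\<in>J1. prob (E (Inl i))) * (\<Prod>i\<in>J2. prob (E (Inr i)))"
      using B by (auto simp: J1_def J2_def)
    also have "\<dots> = (\<Prod>i\<in>J. prob (E i))"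
      unfolding J_eq by (subst prod.union_disjoint) (auto simp: fin prod.reindex)
    finally show "prob (\<Inter>i\<in>J. E i) = (\<Prod>i\<in>J. prob (E i))" .
  qed
qed

lemma (in prob_space) indep_var_nn_integral:
  fixes X Y :: "'a \<Rightarrow> ennreal"
  assumes "indep_var borel X borel Y"
  shows "(\<integral>\<^sup>+\<omega>. X \<omega> * Y \<omega> \<partial>M) = (\<integral>\<^sup>+\<omega>. X \<omega> \<partial>M) * (\<integral>\<^sup>+\<omega>. Y \<omega> \<partial>M)"
proof -
  have "case_bool borel borel = (\<lambda>_. borel :: ennreal measure)"
    by (auto simp: fun_eq_iff split: bool.split)
  then have "indep_vars (\<lambda>_. borel) (case_bool X Y) UNIV"
    using assms by (simp add: indep_var_def)
  from indep_vars_nn_integral[OF _ this] show ?thesis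
    by (simp add: UNIV_bool mult.commute)
qed

text \<open>Up to the factor \<open>1 / (1 - s)\<close>, multiplying the density by \<open>exp (s * x)\<close> gives the exponential
  density of rate \<open>1 - s\<close>.\<close>
lemma (in prob_space) nn_integral_exp_exponential_distributed:
  assumes D: "distributed M lborel X (exponential_density 1)" and s: "s < 1"
  shows "(\<integral>\<^sup>+\<omega>. ennreal (exp (s * X \<omega>)) \<partial>M) = ennreal (1 / (1 - s))"
proof -
  have "(\<integral>\<^sup>+\<omega>. ennreal (exp (s * X \<omega>)) \<partial>M)
      = (\<integral>\<^sup>+x. ennreal (exponential_density 1 x) * ennreal (exp (s * x)) \<partial>lborel)"
    by (rule distributed_nn_integral[OF D, symmetric]) simp
  also have "\<dots> = (\<integral>\<^sup>+x. ennreal (1 / (1 - s)) * ennreal (exponential_density (1 - s) x) \<partial>lborel)"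
  proof (rule nn_integral_cong)
    fix x
    have "exponential_density 1 x * exp (s * x) = 1 / (1 - s) * exponential_density (1 - s) x"
      using s by (simp add: exponential_density_def exp_add[symmetric] right_diff_distrib mult.commute)
    then show "ennreal (exponential_density 1 x) * ennreal (exp (s * x))
        = ennreal (1 / (1 - s)) * ennreal (exponential_density (1 - s) x)"
      using s by (simp add: ennreal_mult'[symmetric] ennreal_mult''[symmetric] exponential_density_nonneg)
  qed
  also have "\<dots> = ennreal (1 / (1 - s)) * (\<integral>\<^sup>+x. ennreal (exponential_density (1 - s) x) \<partial>lborel)"
    by (rule nn_integral_cmult) simp
  also have "(\<integral>\<^sup>+x. ennreal (exponential_density (1 - s) x) \<partial>lborel) = 1"
    using prob_space.emeasure_space_1[OF prob_space_exponential_density[of "1 - s"]] s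
    by (simp add: emeasure_density)
  finally show ?thesis by simp
qed

lemma (in prob_space) prob_ge_le_exp_moment:
  assumes X [measurable]: "X \<in> borel_measurable M" and "0 \<le> s" "0 \<le> C"
    and mgf: "(\<integral>\<^sup>+\<omega>. ennreal (exp (s * X \<omega>)) \<partial>M) \<le> ennreal C"
  shows "prob {\<omega> \<in> space M. c \<le> X \<omega>} \<le> exp (- (s * c)) * C"
proof -
  have "emeasure M {\<omega> \<in> space M. c \<le> X \<omega>} = (\<integral>\<^sup>+\<omega>. indicator {\<omega> \<in> space M. c \<le> X \<omega>} \<omega> \<partial>M)"
    by simp
  also have "\<dots> \<le> (\<integral>\<^sup>+\<omega>. ennreal (exp (- (s * c))) * ennreal (exp (s * X \<omega>)) \<partial>M)"
    using \<open>0 \<le> s\<close> by (intro nn_integral_mono)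
      (auto simp: ennreal_mult'[symmetric] exp_add[symmetric] mult_left_mono split: split_indicator)
  also have "\<dots> = ennreal (exp (- (s * c))) * (\<integral>\<^sup>+\<omega>. ennreal (exp (s * X \<omega>)) \<partial>M)"
    by (rule nn_integral_cmult) simp
  also have "\<dots> \<le> ennreal (exp (- (s * c))) * ennreal C"
    by (intro mult_left_mono mgf) simp
  finally show ?thesis
    using \<open>0 \<le> C\<close> by (simp add: emeasure_eq_measure ennreal_mult'[symmetric])
qed

section \<open>The model: independence and convergence of the series\<close>

context bernoulli_exponential
begin

abbreviation coords :: "nat + nat \<Rightarrow> 'w \<Rightarrow> real" where
  "coords \<equiv> case_sum \<kappa> \<theta>"

lemma measurable_\<kappa> [measurable]: "\<kappa> n \<in> borel_measurable M"
  using indep_\<kappa> by (auto simp: indep_vars_def)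

lemma measurable_\<theta> [measurable]: "\<theta> n \<in> borel_measurable M"
  using indep_\<theta> by (auto simp: indep_vars_def)

lemma \<alpha>_bounds: "0 \<le> \<alpha>" "\<alpha> \<le> 1"
  using \<kappa>_0[of 0] \<kappa>_1[of 0] measure_nonneg[of M] by (metis diff_ge_0_iff_ge)+

lemma indep_coords: "indep_vars (\<lambda>_. borel) coords UNIV"
  by (rule indep_vars_case_sum[OF indep_\<kappa> indep_\<theta> indep_\<kappa>_\<theta>])

text \<open>\<open>f\<close> and \<open>g\<close> say how a quantity is computed from the variables that it reads, so
  independence reduces to checking that two quantities read disjoint sets of variables.\<close>
lemma indep_var_disjoint:
  assumes "A \<inter> B = {}" "f \<in> Pi\<^sub>M A (\<lambda>_. borel) \<rightarrow>\<^sub>M N" "g \<in> Pi\<^sub>M B (\<lambda>_. borel) \<rightarrow>\<^sub>M N'"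
  shows "indep_var N (\<lambda>\<omega>. f (\<lambda>i\<in>A. coords i \<omega>)) N' (\<lambda>\<omega>. g (\<lambda>i\<in>B. coords i \<omega>))"
  using indep_var_compose[OF indep_var_restrict[OF indep_coords assms(1)] assms(2,3)]
  by (simp add: comp_def)

lemma AE_\<kappa>: "AE \<omega> in M. \<kappa> n \<omega> = 0 \<or> \<kappa> n \<omega> = 1"
proof -
  have "prob ({\<omega> \<in> space M. \<kappa> n \<omega> = 0} \<union> {\<omega> \<in> space M. \<kappa> n \<omega> = 1})
      = prob {\<omega> \<in> space M. \<kappa> n \<omega> = 0} + prob {\<omega> \<in> space M. \<kappa> n \<omega> = 1}"
    by (rule finite_measure_Union) auto
  then have "prob ({\<omega> \<in> space M. \<kappa> n \<omega> = 0} \<union> {\<omega> \<in> space M. \<kappa> n \<omega> = 1}) = 1"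
    by (simp add: \<kappa>_0 \<kappa>_1)
  from AE_prob_1[OF this] show ?thesis by eventually_elim auto
qed

lemma prob_\<theta>_gt: "0 \<le> x \<Longrightarrow> prob {\<omega> \<in> space M. x < \<theta> n \<omega>} = exp (- x)"
  using exponential_distributedD_gt[OF \<theta>_exponential, of x] by simp

lemma AE_\<theta>: "AE \<omega> in M. 0 \<le> \<theta> n \<omega>"
  using AE_prob_1[of "{\<omega> \<in> space M. 0 < \<theta> n \<omega>}"] prob_\<theta>_gt[of 0 n] by (auto elim: eventually_mono)

text \<open>The series has expectation at most \<open>4 * (\<Sum>k. a k)\<close>, because \<open>x \<le> 2 * exp (x / 2)\<close> and
  \<open>exp (\<theta> / 2)\<close> has expectation \<open>2\<close>. The shift \<open>m\<close> lets the lemma speak of the remainder series.\<close>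
lemma AE_summable_weighted_\<theta>:
  assumes a: "\<And>k. 0 \<le> a k" "summable a"
  shows "AE \<omega> in M. summable (\<lambda>k. a k * \<theta> (m + k) \<omega>)"
proof -
  have "(\<integral>\<^sup>+\<omega>. ennreal (a k * \<theta> (m + k) \<omega>) \<partial>M) \<le> ennreal (4 * a k)" for k
  proof -
    have "a k * \<theta> (m + k) \<omega> \<le> 2 * a k * exp (1/2 * \<theta> (m + k) \<omega>)" for \<omega>
      using mult_left_mono[OF exp_ge_add_one_self[of "1/2 * \<theta> (m + k) \<omega>"], of "2 * a k"] a(1)[of k]
      by (simp add: algebra_simps)
    then have "(\<integral>\<^sup>+\<omega>. ennreal (a k * \<theta> (m + k) \<omega>) \<partial>M)
        \<le> (\<integral>\<^sup>+\<omega>. ennreal (2 * a k) * ennreal (exp (1/2 * \<theta> (m + k) \<omega>)) \<partial>M)"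
      using a(1) by (intro nn_integral_mono) (simp add: ennreal_mult'[symmetric] ennreal_leI)
    also have "\<dots> = ennreal (2 * a k) * ennreal 2"
      using nn_integral_exp_exponential_distributed[OF \<theta>_exponential, of "1/2" "m + k"]
      by (subst nn_integral_cmult) simp_all
    also have "\<dots> = ennreal (4 * a k)"
      using a(1) by (simp add: ennreal_mult[symmetric] del: ennreal_numeral)
    finally show ?thesis .
  qed
  then have "(\<integral>\<^sup>+\<omega>. (\<Sum>k. ennreal (a k * \<theta> (m + k) \<omega>)) \<partial>M) \<le> (\<Sum>k. ennreal (4 * a k))"
    by (subst nn_integral_suminf) (auto intro!: suminf_le)
  also have "\<dots> < \<infinity>"
    using a summable_mult[OF a(2), of 4] by (subst suminf_ennreal2) auto
  finally have "AE \<omega> in M. (\<Sum>k. ennreal (a k * \<theta> (m + k) \<omega>)) \<noteq> \<infinity>"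
    by (intro nn_integral_noteq_infinite) auto
  moreover have "AE \<omega> in M. \<forall>k. 0 \<le> \<theta> (m + k) \<omega>"
    using AE_\<theta> by (simp add: AE_all_countable)
  ultimately show ?thesis
    by eventually_elim (auto intro!: summable_suminf_not_top mult_nonneg_nonneg a)
qed

lemma AE_\<kappa>_all: "AE \<omega> in M. \<forall>n. \<kappa> n \<omega> = 0 \<or> \<kappa> n \<omega> = 1"
  using AE_\<kappa> by (simp add: AE_all_countable)

lemma AE_\<theta>_all: "AE \<omega> in M. \<forall>n. 0 \<le> \<theta> n \<omega>"
  using AE_\<theta> by (simp add: AE_all_countable)

lemma AE_summable_weighted:
  assumes a: "\<And>k. 0 \<le> a k" "summable a"
  shows "AE \<omega> in M. summable (\<lambda>k. a k * \<kappa> (m + k) \<omega> * \<theta> (m + k) \<omega>)"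
  using AE_\<kappa>_all AE_\<theta>_all AE_summable_weighted_\<theta>[OF a, of m]
proof eventually_elim
  case (elim \<omega>)
  show ?case
  proof (rule summable_comparison_test'[OF elim(3), where N = 0])
    fix k
    show "norm (a k * \<kappa> (m + k) \<omega> * \<theta> (m + k) \<omega>) \<le> a k * \<theta> (m + k) \<omega>"
      using elim(1)[rule_format, of "m + k"] elim(2)[rule_format, of "m + k"] a(1)[of k] by auto
  qed
qed

lemma nn_integral_exp_\<kappa>_\<theta>:
  assumes s: "s < 1"
  shows "(\<integral>\<^sup>+\<omega>. ennreal (exp (s * (\<kappa> n \<omega> * \<theta> n \<omega>))) \<partial>M) = ennreal (\<alpha> + (1 - \<alpha>) / (1 - s))"
proof -
  have ind: "indep_var borel (\<lambda>\<omega>. indicator {1} (\<kappa> n \<omega>) :: ennreal) borel (\<lambda>\<omega>. ennreal (exp (s * \<theta> n \<omega>)))"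
    using indep_var_disjoint[of "{Inl n}" "{Inr n}" "\<lambda>z. indicator {1} (z (Inl n)) :: ennreal" borel
        "\<lambda>z. ennreal (exp (s * z (Inr n)))" borel] by simp
  have ind_prob: "(\<integral>\<^sup>+\<omega>. indicator {c} (\<kappa> n \<omega>) \<partial>M) = ennreal (prob {\<omega> \<in> space M. \<kappa> n \<omega> = c})" for c
  proof -
    have "(\<integral>\<^sup>+\<omega>. indicator {c} (\<kappa> n \<omega>) \<partial>M) = (\<integral>\<^sup>+\<omega>. indicator {\<omega> \<in> space M. \<kappa> n \<omega> = c} \<omega> \<partial>M)"
      by (intro nn_integral_cong) (auto simp: indicator_def)
    then show ?thesis by (simp add: emeasure_eq_measure)
  qed
  have "(\<integral>\<^sup>+\<omega>. ennreal (exp (s * (\<kappa> n \<omega> * \<theta> n \<omega>))) \<partial>M)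
      = (\<integral>\<^sup>+\<omega>. indicator {0} (\<kappa> n \<omega>) + indicator {1} (\<kappa> n \<omega>) * ennreal (exp (s * \<theta> n \<omega>)) \<partial>M)"
    by (rule nn_integral_cong_AE, use AE_\<kappa>[of n] in eventually_elim) auto
  also have "\<dots> = (\<integral>\<^sup>+\<omega>. indicator {0} (\<kappa> n \<omega>) \<partial>M)
      + (\<integral>\<^sup>+\<omega>. indicator {1} (\<kappa> n \<omega>) * ennreal (exp (s * \<theta> n \<omega>)) \<partial>M)"
    by (rule nn_integral_add) auto
  also have "\<dots> = ennreal \<alpha> + ennreal (1 - \<alpha>) * ennreal (1 / (1 - s))"
    by (simp only: indep_var_nn_integral[OF ind] ind_prob \<kappa>_0 \<kappa>_1
        nn_integral_exp_exponential_distributed[OF \<theta>_exponential s])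
  also have "\<dots> = ennreal (\<alpha> + (1 - \<alpha>) / (1 - s))"
    using \<alpha>_bounds s by (simp add: ennreal_mult'[symmetric] ennreal_plus[symmetric] del: ennreal_plus)
  finally show ?thesis .
qed

lemma indep_\<kappa>\<theta>: "indep_vars (\<lambda>_. borel) (\<lambda>k \<omega>. \<kappa> k \<omega> * \<theta> k \<omega>) UNIV"
proof -
  have "indep_vars (\<lambda>k. Pi\<^sub>M {Inl k, Inr k} (\<lambda>_. borel)) (\<lambda>k \<omega>. \<lambda>i\<in>{Inl k, Inr k}. coords i \<omega>) UNIV"
    by (rule indep_vars_restrict[OF indep_coords]) (auto simp: disjoint_family_on_def)
  from indep_vars_compose2[OF this, of "\<lambda>k z. z (Inl k) * z (Inr k)" "\<lambda>_. borel"]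
  show ?thesis by simp
qed

section \<open>Exponential moments of weighted sums\<close>

text \<open>The moment generating function of a single \<open>\<kappa> * \<theta>\<close> at \<open>x < 1\<close> is
  \<open>\<alpha> + (1 - \<alpha>) / (1 - x) = 1 + (1 - \<alpha>) * x / (1 - x)\<close>, hence at most
  \<open>exp ((1 - \<alpha>) * x / (1 - x))\<close>. With \<open>x / (1 - x)\<close> bounded linearly by \<open>c\<close>, the product over
  finitely many terms depends on the sum of the weights only, and Fatou's lemma carries the bound to
  the series. Both signs of \<open>s\<close> are needed: positive for the upper tail, negative for the
  lower tail.\<close>
lemma nn_integral_exp_weighted_sum_le:
  assumes b: "\<And>k. 0 \<le> b k" "summable b" and s: "\<And>k. s * b k < 1"
    and c: "\<And>k. s * b k / (1 - s * b k) \<le> c * b k"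
  shows "(\<integral>\<^sup>+\<omega>. ennreal (exp (s * (\<Sum>k. b k * \<kappa> (m + k) \<omega> * \<theta> (m + k) \<omega>))) \<partial>M)
    \<le> ennreal (exp (c * ((1 - \<alpha>) * (\<Sum>k. b k))))"
proof -
  let ?X = "\<lambda>k \<omega>. \<kappa> (m + k) \<omega> * \<theta> (m + k) \<omega>"
  have fin: "(\<integral>\<^sup>+\<omega>. ennreal (exp (s * (\<Sum>k<N. b k * ?X k \<omega>))) \<partial>M)
      \<le> ennreal (exp (c * ((1 - \<alpha>) * (\<Sum>k<N. b k))))" for N
  proof -
    \<comment> \<open>Restricting to singletons re-indexes the family by the shift \<open>m\<close>.\<close>
    have ind: "indep_vars (\<lambda>_. borel) (\<lambda>k \<omega>. ennreal (exp (s * b k * ?X k \<omega>))) {..<N}"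
    proof -
      have "indep_vars (\<lambda>k. Pi\<^sub>M {m + k} (\<lambda>_. borel)) (\<lambda>k \<omega>. \<lambda>i\<in>{m + k}. \<kappa> i \<omega> * \<theta> i \<omega>) {..<N}"
        by (rule indep_vars_restrict[OF indep_\<kappa>\<theta>]) (auto simp: disjoint_family_on_def)
      from indep_vars_compose2[OF this, of "\<lambda>k z. ennreal (exp (s * b k * z (m + k)))" "\<lambda>_. borel"]
      show ?thesis by simp
    qed
    have "(\<integral>\<^sup>+\<omega>. ennreal (exp (s * (\<Sum>k<N. b k * ?X k \<omega>))) \<partial>M)
        = (\<integral>\<^sup>+\<omega>. (\<Prod>k<N. ennreal (exp (s * b k * ?X k \<omega>))) \<partial>M)"
      by (intro nn_integral_cong)
        (simp add: prod_ennreal exp_sum[symmetric] sum_distrib_left mult.assoc)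
    also have "\<dots> = (\<Prod>k<N. ennreal (\<alpha> + (1 - \<alpha>) / (1 - s * b k)))"
      by (subst indep_vars_nn_integral[OF _ ind]) (simp_all add: nn_integral_exp_\<kappa>_\<theta>[OF s])
    also have "\<dots> \<le> (\<Prod>k<N. ennreal (exp (c * ((1 - \<alpha>) * b k))))"
    proof (intro prod_mono_ennreal ennreal_leI)
      fix k
      have "\<alpha> + (1 - \<alpha>) / (1 - s * b k) = 1 + (1 - \<alpha>) * (s * b k / (1 - s * b k))"
        using s[of k] by (simp add: field_simps)
      also have "\<dots> \<le> 1 + (1 - \<alpha>) * (c * b k)"
        using \<alpha>_bounds c by (intro add_left_mono mult_left_mono) auto
      also have "\<dots> \<le> exp (c * ((1 - \<alpha>) * b k))"
        using exp_ge_add_one_self[of "c * ((1 - \<alpha>) * b k)"] by (simp add: algebra_simps)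
      finally show "\<alpha> + (1 - \<alpha>) / (1 - s * b k) \<le> exp (c * ((1 - \<alpha>) * b k))" .
    qed
    also have "\<dots> = ennreal (exp (c * ((1 - \<alpha>) * (\<Sum>k<N. b k))))"
      by (simp add: prod_ennreal exp_sum[symmetric] sum_distrib_left)
    finally show ?thesis .
  qed
  have conv: "AE \<omega> in M. (\<lambda>N. ennreal (exp (s * (\<Sum>k<N. b k * ?X k \<omega>))))
      \<longlonglongrightarrow> ennreal (exp (s * (\<Sum>k. b k * ?X k \<omega>)))"
    using AE_summable_weighted[OF b, of m]
    by eventually_elim (intro tendsto_intros summable_LIMSEQ, simp add: mult.assoc)
  have lim: "(\<lambda>N. ennreal (exp (c * ((1 - \<alpha>) * (\<Sum>k<N. b k)))))
      \<longlonglongrightarrow> ennreal (exp (c * ((1 - \<alpha>) * (\<Sum>k. b k))))"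
    by (intro tendsto_intros summable_LIMSEQ b)
  have "(\<integral>\<^sup>+\<omega>. ennreal (exp (s * (\<Sum>k. b k * ?X k \<omega>))) \<partial>M)
      = (\<integral>\<^sup>+\<omega>. liminf (\<lambda>N. ennreal (exp (s * (\<Sum>k<N. b k * ?X k \<omega>)))) \<partial>M)"
    by (rule nn_integral_cong_AE, use conv in eventually_elim)
      (auto intro!: lim_imp_Liminf[symmetric])
  also have "\<dots> \<le> liminf (\<lambda>N. \<integral>\<^sup>+\<omega>. ennreal (exp (s * (\<Sum>k<N. b k * ?X k \<omega>))) \<partial>M)"
    by (rule nn_integral_liminf) auto
  also have "\<dots> \<le> liminf (\<lambda>N. ennreal (exp (c * ((1 - \<alpha>) * (\<Sum>k<N. b k)))))"
    by (intro Liminf_mono always_eventually allI fin)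
  also have "\<dots> = ennreal (exp (c * ((1 - \<alpha>) * (\<Sum>k. b k))))"
    by (intro lim_imp_Liminf lim) simp
  finally show ?thesis by (simp add: mult.assoc)
qed

section \<open>Decomposition by the first success\<close>

definition later_sum :: "(nat \<Rightarrow> real) \<Rightarrow> nat \<Rightarrow> 'w \<Rightarrow> real" where
  "later_sum a n \<omega> = (\<Sum>k. a (Suc n + k) * \<kappa> (Suc n + k) \<omega> * \<theta> (Suc n + k) \<omega>)"

definition later_mean :: "(nat \<Rightarrow> real) \<Rightarrow> nat \<Rightarrow> real" where
  "later_mean a n = (1 - \<alpha>) * (\<Sum>k. a (Suc n + k))"

lemma measurable_later_sum [measurable]: "later_sum a n \<in> borel_measurable M"
  unfolding later_sum_def[abs_def] by measurable

lemma measurable_later_sum_coordinates: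
  assumes "\<And>k. n < k \<Longrightarrow> Inl k \<in> B \<and> Inr k \<in> B"
  shows "(\<lambda>z. \<Sum>k. a (Suc n + k) * z (Inl (Suc n + k)) * z (Inr (Suc n + k)))
    \<in> Pi\<^sub>M B (\<lambda>_. borel) \<rightarrow>\<^sub>M (borel :: real measure)"
  using assms by (intro borel_measurable_suminf borel_measurable_times measurable_component_singleton) auto

lemma indep_\<theta>_later_sum: "indep_var borel (\<theta> n) borel (later_sum a n)"
proof -
  let ?B = "Inl ` {n<..} \<union> Inr ` {n<..} :: (nat + nat) set"
  have "indep_var borel (\<lambda>\<omega>. (\<lambda>z. z (Inr n)) (\<lambda>i\<in>{Inr n}. coords i \<omega>))
      borel (\<lambda>\<omega>. (\<lambda>z. \<Sum>k. a (Suc n + k) * z (Inl (Suc n + k)) * z (Inr (Suc n + k))) (\<lambda>i\<in>?B. coords i \<omega>))"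
    by (rule indep_var_disjoint[OF _ _ measurable_later_sum_coordinates]) auto
  then show ?thesis
    by (simp add: later_sum_def[abs_def] image_iff)
qed

text \<open>The first index \<open>n\<close> with \<open>\<kappa> n = 1\<close> is determined by \<open>\<kappa> 0, \<dots>, \<kappa> n\<close>, while the sum that is
  left once \<open>\<kappa> n = 1\<close> is known reads \<open>\<theta> n\<close> and the variables of larger index.\<close>
lemma prob_first_success_and_tail:
  "prob {\<omega> \<in> space M. ((\<forall>j<n. \<kappa> j \<omega> = 0) \<and> \<kappa> n \<omega> = 1) \<and> c \<le> a n * \<theta> n \<omega> + later_sum a n \<omega>}
    = (1 - \<alpha>) * \<alpha> ^ n * prob {\<omega> \<in> space M. c \<le> a n * \<theta> n \<omega> + later_sum a n \<omega>}"
proof -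
  let ?F = "\<lambda>\<omega>. (\<forall>j<n. \<kappa> j \<omega> = 0) \<and> \<kappa> n \<omega> = 1"
  let ?T = "\<lambda>\<omega>. a n * \<theta> n \<omega> + later_sum a n \<omega>"
  let ?A = "Inl ` {..n} :: (nat + nat) set"
  let ?B = "Inl ` {n<..} \<union> Inr ` {n..} :: (nat + nat) set"
  have meas_F: "(\<lambda>z. of_bool ((\<forall>j<n. z (Inl j) = 0) \<and> z (Inl n) = 1) :: real)
      \<in> Pi\<^sub>M ?A (\<lambda>_. borel :: real measure) \<rightarrow>\<^sub>M borel"
  proof -
    have [measurable]: "(\<lambda>z. z (Inl j)) \<in> Pi\<^sub>M ?A (\<lambda>_. borel) \<rightarrow>\<^sub>M (borel :: real measure)" if "j \<le> n" for j
      using that by (intro measurable_component_singleton) auto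
    show ?thesis unfolding of_bool_def by measurable
  qed
  have meas_T: "(\<lambda>z. a n * z (Inr n) + (\<Sum>k. a (Suc n + k) * z (Inl (Suc n + k)) * z (Inr (Suc n + k))))
      \<in> Pi\<^sub>M ?B (\<lambda>_. borel) \<rightarrow>\<^sub>M borel"
    by (intro borel_measurable_add borel_measurable_times measurable_const measurable_later_sum_coordinates
        measurable_component_singleton) auto
  have "?A \<inter> ?B = {}" by auto
  from indep_var_disjoint[OF this meas_F meas_T]
  have ind: "indep_var borel (\<lambda>\<omega>. of_bool (?F \<omega>) :: real) borel ?T"
    by (simp add: later_sum_def[abs_def] image_iff)
  have atMost_eq: "{..n} = insert n {..<n}" by auto
  define B :: "nat \<Rightarrow> real set" where "B j = (if j < n then {0} else {1})" for j
  have "prob (\<Inter>j\<in>{..n}. \<kappa> j -` B j \<inter> space M) = (\<Prod>j\<in>{..n}. prob (\<kappa> j -` B j \<inter> space M))"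
    by (rule indep_varsD[OF indep_\<kappa>]) (auto simp: B_def)
  also have "\<dots> = (\<Prod>j\<in>{..n}. if j < n then \<alpha> else 1 - \<alpha>)"
  proof (rule prod.cong)
    fix j
    have "\<kappa> j -` B j \<inter> space M
        = (if j < n then {\<omega> \<in> space M. \<kappa> j \<omega> = 0} else {\<omega> \<in> space M. \<kappa> j \<omega> = 1})"
      by (auto simp: B_def)
    then show "prob (\<kappa> j -` B j \<inter> space M) = (if j < n then \<alpha> else 1 - \<alpha>)"
      using \<kappa>_0[of j] \<kappa>_1[of j] by presburger
  qed simp
  also have "\<dots> = (1 - \<alpha>) * \<alpha> ^ n"
    by (simp add: atMost_eq)
  also have "(\<Inter>j\<in>{..n}. \<kappa> j -` B j \<inter> space M) = {\<omega> \<in> space M. ?F \<omega>}"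
  proof -
    have B_iff: "(\<forall>j\<in>{..n}. \<kappa> j \<omega> \<in> B j) \<longleftrightarrow> ?F \<omega>" for \<omega>
      unfolding atMost_eq B_def by force
    have "n \<in> {..n}" by simp
    then have "(\<Inter>j\<in>{..n}. \<kappa> j -` B j \<inter> space M) = {\<omega> \<in> space M. \<forall>j\<in>{..n}. \<kappa> j \<omega> \<in> B j}"
      by blast
    also have "\<dots> = {\<omega> \<in> space M. ?F \<omega>}"
      by (simp only: B_iff)
    finally show ?thesis .
  qed
  finally have "prob {\<omega> \<in> space M. ?F \<omega>} = (1 - \<alpha>) * \<alpha> ^ n" .
  then show ?thesis
    using prob_indep_random_variable[OF ind, of "{1}" "{c..}"] by simp
qed

text \<open>Split by the first index \<open>n\<close> with \<open>\<kappa> n = 1\<close>: the terms before \<open>n\<close> vanish. If there is no such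
  index, then the sum is \<open>0\<close>, which is below \<open>c\<close>.\<close>
lemma first_success_decomposition:
  assumes a: "\<And>k. 0 \<le> a k" "summable a" and c: "0 < c"
  shows "(\<lambda>n. (1 - \<alpha>) * \<alpha> ^ n * prob {\<omega> \<in> space M. c \<le> a n * \<theta> n \<omega> + later_sum a n \<omega>})
    sums prob {\<omega> \<in> space M. c \<le> (\<Sum>n. a n * \<kappa> n \<omega> * \<theta> n \<omega>)}"
proof -
  let ?S = "\<lambda>\<omega>. \<Sum>n. a n * \<kappa> n \<omega> * \<theta> n \<omega>"
  let ?T = "\<lambda>n \<omega>. a n * \<theta> n \<omega> + later_sum a n \<omega>"
  let ?F = "\<lambda>n \<omega>. (\<forall>j<n. \<kappa> j \<omega> = 0) \<and> \<kappa> n \<omega> = 1"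
  let ?E = "\<lambda>n. {\<omega> \<in> space M. ?F n \<omega> \<and> c \<le> ?T n \<omega>}"
  have disj: "disjoint_family ?E"
    unfolding disjoint_family_on_def
  proof (intro ballI impI)
    fix m n :: nat assume "m \<noteq> n"
    then consider "m < n" | "n < m" by linarith
    then show "?E m \<inter> ?E n = {}" by cases auto
  qed
  have S_eq: "?S \<omega> = ?T n \<omega>" if F: "?F n \<omega>" and "summable (\<lambda>k. a k * \<kappa> k \<omega> * \<theta> k \<omega>)" for n \<omega>
  proof -
    have "?S \<omega> = (\<Sum>k. a (k + Suc n) * \<kappa> (k + Suc n) \<omega> * \<theta> (k + Suc n) \<omega>)
        + (\<Sum>k<Suc n. a k * \<kappa> k \<omega> * \<theta> k \<omega>)"
      by (rule suminf_split_initial_segment) fact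
    moreover have "(\<Sum>k<n. a k * \<kappa> k \<omega> * \<theta> k \<omega>) = 0"
      using F by (intro sum.neutral) auto
    ultimately show ?thesis
      using F by (simp add: later_sum_def add.commute)
  qed
  have "AE \<omega> in M. \<omega> \<in> {\<omega> \<in> space M. c \<le> ?S \<omega>} \<longleftrightarrow> \<omega> \<in> (\<Union>n. ?E n)"
    using AE_\<kappa>_all AE_summable_weighted[OF a, of 0] AE_space
  proof eventually_elim
    case (elim \<omega>)
    have ex: "\<exists>n. ?F n \<omega>" if "c \<le> ?S \<omega>"
    proof -
      have "\<exists>n. \<kappa> n \<omega> \<noteq> 0"
      proof (rule ccontr)
        assume "\<nexists>n. \<kappa> n \<omega> \<noteq> 0"
        then have "?S \<omega> = 0" by simp
        with that c show False by simp
      qed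
      then obtain n where "\<kappa> n \<omega> \<noteq> 0" "\<forall>j<n. \<kappa> j \<omega> = 0"
        using exists_least_iff[of "\<lambda>n. \<kappa> n \<omega> \<noteq> 0"] by auto
      then show ?thesis using elim(1) by blast
    qed
    have summ: "summable (\<lambda>k. a k * \<kappa> k \<omega> * \<theta> k \<omega>)"
      using elim(2) by simp
    show ?case
    proof
      assume "\<omega> \<in> {\<omega> \<in> space M. c \<le> ?S \<omega>}"
      then have "c \<le> ?S \<omega>" by blast
      moreover from ex[OF this] obtain n where n: "?F n \<omega>" ..
      ultimately have "c \<le> ?T n \<omega>" unfolding S_eq[OF n summ] by blast
      with n elim(3) show "\<omega> \<in> (\<Union>n. ?E n)" by blast
    next
      assume "\<omega> \<in> (\<Union>n. ?E n)"
      then obtain n where n: "?F n \<omega>" and "c \<le> ?T n \<omega>" by blast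
      then have "c \<le> ?S \<omega>" unfolding S_eq[OF n summ] by blast
      with elim(3) show "\<omega> \<in> {\<omega> \<in> space M. c \<le> ?S \<omega>}" by blast
    qed
  qed
  moreover have E: "?E n \<in> events" for n
    by measurable
  moreover have "{\<omega> \<in> space M. c \<le> ?S \<omega>} \<in> events"
    by measurable
  ultimately have "prob {\<omega> \<in> space M. c \<le> ?S \<omega>} = prob (\<Union>n. ?E n)"
    by (intro finite_measure_eq_AE sets.countable_UN) blast+
  moreover have "(\<lambda>n. prob (?E n)) sums prob (\<Union>n. ?E n)"
    using E disj by (intro finite_measure_UNION image_subsetI)
  ultimately show ?thesis
    unfolding prob_first_success_and_tail by (simp only:)
qed

section \<open>Tail estimates for a single term\<close>

lemma later_weights:
  assumes "antimono a" "\<And>k. 0 \<le> a k" "summable a"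
  shows "summable (\<lambda>k. a (Suc n + k))" "a (Suc n + k) \<le> a n" "0 \<le> later_mean a n"
proof -
  show *: "summable (\<lambda>k. a (Suc n + k))"
    using summable_ignore_initial_segment[OF assms(3), of "Suc n"] by (simp add: add.commute)
  show "a (Suc n + k) \<le> a n"
    using assms(1) by (auto intro: antimonoD)
  show "0 \<le> later_mean a n"
    using \<alpha>_bounds assms(2) * by (auto simp: later_mean_def intro!: mult_nonneg_nonneg suminf_nonneg)
qed

text \<open>Exponential Markov inequality with exponent \<open>1 / (2 * a n)\<close>. With \<open>m = later_mean a n\<close> the
  exponential moment is at most \<open>2 * exp (m / a n)\<close>, while
  \<open>4 * t / (2 * a n) = 2 * p + 2 * m / a n\<close>, so \<open>m\<close> is absorbed and one of the two copies
  of \<open>p \<ge> 2\<close> pays for the factor \<open>2\<close>.\<close>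
lemma prob_tail_upper:
  assumes a: "antimono a" "\<And>k. 0 \<le> a k" "summable a" and an: "0 < a n"
    and t: "t = p * a n + later_mean a n" and p: "2 \<le> p"
  shows "prob {\<omega> \<in> space M. 4 * t \<le> a n * \<theta> n \<omega> + later_sum a n \<omega>} \<le> exp (- p)"
proof -
  let ?T = "\<lambda>\<omega>. a n * \<theta> n \<omega> + later_sum a n \<omega>" and ?s = "1 / (2 * a n)" and ?m = "later_mean a n"
  have R: "(\<integral>\<^sup>+\<omega>. ennreal (exp (?s * later_sum a n \<omega>)) \<partial>M) \<le> ennreal (exp (?m / a n))"
  proof -
    have x: "?s * a (Suc n + k) \<le> 1/2" for k
      using later_weights(2)[OF a, of n k] an by (simp add: field_simps)
    have "?s * a (Suc n + k) / (1 - ?s * a (Suc n + k)) \<le> 1 / a n * a (Suc n + k)" for k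
    proof -
      define x where "x = ?s * a (Suc n + k)"
      have "0 \<le> x" "x \<le> 1/2" using x a(2) an by (auto simp: x_def)
      then have "x / (1 - x) \<le> x / (1/2)" by (intro divide_left_mono) auto
      then show ?thesis using an by (simp add: x_def)
    qed
    moreover have "?s * a (Suc n + k) < 1" for k
      using x[of k] by linarith
    ultimately show ?thesis
      using nn_integral_exp_weighted_sum_le[where s = ?s and m = "Suc n" and c = "1 / a n",
          OF a(2) later_weights(1)[OF a]]
      by (simp add: later_sum_def later_mean_def)
  qed
  have "indep_var borel ((\<lambda>x. ennreal (exp (1/2 * x))) \<circ> \<theta> n) borel ((\<lambda>x. ennreal (exp (?s * x))) \<circ> later_sum a n)"
    by (rule indep_var_compose[OF indep_\<theta>_later_sum]) auto
  from indep_var_nn_integral[OF this]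
  have "(\<integral>\<^sup>+\<omega>. ennreal (exp (?s * ?T \<omega>)) \<partial>M)
      = (\<integral>\<^sup>+\<omega>. ennreal (exp (1/2 * \<theta> n \<omega>)) \<partial>M) * (\<integral>\<^sup>+\<omega>. ennreal (exp (?s * later_sum a n \<omega>)) \<partial>M)"
    using an by (simp add: ennreal_mult'[symmetric] exp_add[symmetric] distrib_left)
  also have "\<dots> \<le> ennreal (1 / (1 - 1/2)) * ennreal (exp (?m / a n))"
    using nn_integral_exp_exponential_distributed[OF \<theta>_exponential, of "1/2" n] R
    by (intro mult_mono) auto
  also have "\<dots> = ennreal (2 * exp (?m / a n))"
    by (simp add: ennreal_mult'[symmetric] ennreal_mult''[symmetric] del: ennreal_numeral)
  finally have "prob {\<omega> \<in> space M. 4 * t \<le> ?T \<omega>} \<le> exp (- (?s * (4 * t))) * (2 * exp (?m / a n))"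
    using an by (intro prob_ge_le_exp_moment) auto
  also have "\<dots> = 2 * exp (- 2 * p - ?m / a n)"
    using an by (simp add: t exp_add[symmetric] field_simps)
  also have "\<dots> \<le> 2 * exp (- 2 * p)"
    using later_weights(3)[OF a] an by simp
  also have "\<dots> \<le> exp p * exp (- 2 * p)"
  proof (rule mult_right_mono)
    show "2 \<le> exp p" using exp_ge_add_one_self[of p] p by linarith
  qed simp
  also have "\<dots> = exp (- p)"
    by (simp add: exp_add[symmetric])
  finally show ?thesis .
qed

text \<open>The remainder is a sum of many small terms as soon as its mean is at least \<open>4 * a n\<close>, and such a
  sum is rarely below a quarter of its mean: by the exponential Markov inequality with exponent
  \<open>- 1 / a n\<close> this has probability at most
  \<open>exp (m / (4 * a n) - m / (2 * a n)) \<le> exp (- 1) \<le> 1 - exp (- 1)\<close>, where \<open>m\<close> is the mean.\<close>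
lemma prob_later_sum_lower:
  assumes a: "antimono a" "\<And>k. 0 \<le> a k" "summable a" and an: "0 < a n"
    and m: "4 * a n \<le> later_mean a n"
  shows "exp (- 1) \<le> prob {\<omega> \<in> space M. later_mean a n / 4 \<le> later_sum a n \<omega>}"
proof -
  let ?s = "- 1 / a n" and ?m = "later_mean a n"
  have "(\<integral>\<^sup>+\<omega>. ennreal (exp (?s * later_sum a n \<omega>)) \<partial>M) \<le> ennreal (exp (- (?m / (2 * a n))))"
  proof -
    have "?s * a (Suc n + k) / (1 - ?s * a (Suc n + k)) \<le> - 1 / (2 * a n) * a (Suc n + k)" for k
    proof -
      define x where "x = a (Suc n + k) / a n"
      have "0 \<le> x" "x \<le> 1" using later_weights(2)[OF a, of n k] a(2) an by (auto simp: x_def)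
      then have "x / 2 \<le> x / (1 + x)" by (intro divide_left_mono) auto
      then show ?thesis using an by (simp add: x_def field_simps)
    qed
    moreover have "?s * a (Suc n + k) < 1" for k
    proof -
      have "0 \<le> a (Suc n + k) / a n" using a(2) an by simp
      then show ?thesis by simp
    qed
    ultimately show ?thesis
      using nn_integral_exp_weighted_sum_le[where s = ?s and m = "Suc n" and c = "- 1 / (2 * a n)",
          OF a(2) later_weights(1)[OF a]]
      by (simp add: later_sum_def later_mean_def)
  qed
  then have "prob {\<omega> \<in> space M. - (?m / 4) \<le> - later_sum a n \<omega>}
      \<le> exp (- (1 / a n * (- (?m / 4)))) * exp (- (?m / (2 * a n)))"
    using an by (intro prob_ge_le_exp_moment) auto
  also have "\<dots> = exp (- (?m / (4 * a n)))"
    using an by (simp add: exp_add[symmetric] field_simps)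
  also have "\<dots> \<le> exp (- 1)"
    using m an by (simp add: field_simps)
  finally have small: "prob {\<omega> \<in> space M. later_sum a n \<omega> \<le> ?m / 4} \<le> exp (- 1)"
    by simp
  have "1 = prob (space M)" by (simp add: prob_space)
  also have "\<dots> \<le> prob ({\<omega> \<in> space M. later_sum a n \<omega> \<le> ?m / 4} \<union> {\<omega> \<in> space M. ?m / 4 \<le> later_sum a n \<omega>})"
    by (intro finite_measure_mono) auto
  also have "\<dots> \<le> prob {\<omega> \<in> space M. later_sum a n \<omega> \<le> ?m / 4} + prob {\<omega> \<in> space M. ?m / 4 \<le> later_sum a n \<omega>}"
    by (intro measure_Un_le) auto
  finally have "1 - exp (- 1) \<le> prob {\<omega> \<in> space M. ?m / 4 \<le> later_sum a n \<omega>}"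
    using small by simp
  moreover have "2 * exp (- 1) \<le> (1 :: real)"
    using exp_ge_add_one_self[of 1] by (simp add: exp_minus field_simps)
  ultimately show ?thesis by linarith
qed

text \<open>If the mean of the remainder is below \<open>4 * a n\<close>, then \<open>t\<close> is comparable to the
  \<open>a n\<close>-term alone: \<open>t \<le> 6 * a n\<close> for \<open>p < 2\<close> and \<open>t \<le> 3 * p * a n\<close> for \<open>p \<ge> 2\<close>, so a large \<open>\<theta> n\<close>
  suffices. Otherwise the remainder contributes a quarter of its mean with probability at least
  \<open>exp (- 1)\<close>, and, independently of that, \<open>\<theta> n\<close> contributes the missing \<open>p * a n\<close> with
  probability \<open>exp (- p)\<close> (for \<open>p < 2\<close> no contribution is missing).\<close>
lemma prob_tail_lower:
  assumes a: "antimono a" "\<And>k. 0 \<le> a k" "summable a" and an: "0 < a n"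
    and t: "t = p * a n + later_mean a n"
  shows "exp (- 1) * (if p < 2 then 1 else exp (- p))
    \<le> prob {\<omega> \<in> space M. t / 6 \<le> a n * \<theta> n \<omega> + later_sum a n \<omega>}"
proof -
  let ?T = "\<lambda>\<omega>. a n * \<theta> n \<omega> + later_sum a n \<omega>" and ?m = "later_mean a n"
  define p' where "p' = (if p < 2 then 0 else p)"
  have weight: "(if p < 2 then 1 else exp (- p)) = exp (- p')" and p': "0 \<le> p'"
    by (auto simp: p'_def)
  have "exp (- 1) * exp (- p') \<le> prob {\<omega> \<in> space M. t / 6 \<le> ?T \<omega>}"
  proof (cases "?m < 4 * a n")
    case True
    \<comment> \<open>A level of at least \<open>t / (6 * a n)\<close> that \<open>\<theta> n\<close> exceeds with probability
      at least \<open>exp (- 1) * exp (- p')\<close>.\<close>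
    define x where "x = (if p < 2 then 1 else p / 2)"
    have x: "0 \<le> x" "x \<le> 1 + p'" by (auto simp: x_def p'_def)
    have tx: "t / 6 \<le> a n * x"
    proof (cases "p < 2")
      case True
      then have "p * a n \<le> 2 * a n" using an by (intro mult_right_mono) auto
      then show ?thesis using \<open>?m < 4 * a n\<close> True by (simp add: t x_def)
    next
      case False
      then have "2 * a n \<le> p * a n" using an by (intro mult_right_mono) auto
      then show ?thesis using \<open>?m < 4 * a n\<close> False by (simp add: t x_def mult.commute)
    qed
    have "AE \<omega> in M. \<omega> \<in> {\<omega> \<in> space M. x < \<theta> n \<omega>} \<longrightarrow> \<omega> \<in> {\<omega> \<in> space M. t / 6 \<le> ?T \<omega>}"
      using AE_\<kappa>_all AE_\<theta>_all AE_summable_weighted[OF a(2) later_weights(1)[OF a, of n], of "Suc n"]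
    proof eventually_elim
      case (elim \<omega>)
      have "0 \<le> a k * \<kappa> k \<omega> * \<theta> k \<omega>" for k
        using elim(1)[rule_format, of k] elim(2) a(2) by auto
      then have "0 \<le> later_sum a n \<omega>"
        unfolding later_sum_def by (intro suminf_nonneg elim(3))
      moreover have "a n * x \<le> a n * \<theta> n \<omega>" if "x < \<theta> n \<omega>"
        using that an by simp
      ultimately show ?case using tx by fastforce
    qed
    then have "prob {\<omega> \<in> space M. x < \<theta> n \<omega>} \<le> prob {\<omega> \<in> space M. t / 6 \<le> ?T \<omega>}"
      by (intro finite_measure_mono_AE) auto
    moreover have "exp (- 1) * exp (- p') \<le> exp (- x)"
      using x by (simp add: exp_add[symmetric])
    ultimately show ?thesis using prob_\<theta>_gt[OF x(1)] by simp
  next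
    case False
    have tp: "t / 6 \<le> a n * p' + ?m / 4"
    proof (cases "p < 2")
      case True
      then have "p * a n \<le> 2 * a n" using an by (intro mult_right_mono) auto
      then show ?thesis using False True by (simp add: t p'_def)
    next
      case False
      then have "0 \<le> p * a n" using an by simp
      then show ?thesis using False later_weights(3)[OF a, of n] by (simp add: t p'_def mult.commute)
    qed
    have "exp (- 1) * exp (- p') \<le> prob {\<omega> \<in> space M. p' < \<theta> n \<omega>} * prob {\<omega> \<in> space M. ?m / 4 \<le> later_sum a n \<omega>}"
      using prob_later_sum_lower[OF a an] False by (simp add: prob_\<theta>_gt[OF p'] mult.commute)
    also have "\<dots> = prob {\<omega> \<in> space M. \<theta> n \<omega> \<in> {p'<..} \<and> later_sum a n \<omega> \<in> {?m / 4..}}"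
      using prob_indep_random_variable[OF indep_\<theta>_later_sum, of "{p'<..}" "{?m / 4..}"] by simp
    also have "\<dots> \<le> prob {\<omega> \<in> space M. t / 6 \<le> ?T \<omega>}"
    proof (rule finite_measure_mono)
      show "{\<omega> \<in> space M. \<theta> n \<omega> \<in> {p'<..} \<and> later_sum a n \<omega> \<in> {?m / 4..}} \<subseteq> {\<omega> \<in> space M. t / 6 \<le> ?T \<omega>}"
      proof safe
        fix \<omega> assume "p' < \<theta> n \<omega>" "?m / 4 \<le> later_sum a n \<omega>"
        moreover from this have "a n * p' \<le> a n * \<theta> n \<omega>" using an by simp
        ultimately show "t / 6 \<le> ?T \<omega>" using tp by linarith
      qed
    qed auto
    finally show ?thesis .
  qed
  then show ?thesis by (simp only: weight)
qed

end

section \<open>The two-sided tail bound\<close>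

text \<open>Collects the two sums of \<open>tail_bound\<close> into one series, to be compared term by term with the
  decomposition by the first success.\<close>
lemma tail_bound_sums:
  assumes \<alpha>: "0 \<le> \<alpha>" "\<alpha> < 1"
    and w: "\<And>n. p_coeff \<alpha> a t n < 2 \<Longrightarrow> w n = 1"
      "\<And>n. 2 \<le> p_coeff \<alpha> a t n \<Longrightarrow> w n = exp_ereal (ereal (- \<beta>) * p_coeff \<alpha> a t n)"
    and w_bounds: "\<And>n. 0 \<le> w n" "\<And>n. w n \<le> 1"
  shows "(\<lambda>n. (1 - \<alpha>) * \<alpha> ^ n * w n) sums tail_bound \<beta> \<alpha> a t"
proof -
  have summ: "(\<lambda>n. \<alpha> ^ n * w n) summable_on UNIV"
  proof (rule norm_summable_imp_summable_on)
    show "summable (\<lambda>n. norm (\<alpha> ^ n * w n))"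
    proof (rule summable_comparison_test'[where N = 0 and g = "\<lambda>n. \<alpha> ^ n"])
      show "norm (norm (\<alpha> ^ n * w n)) \<le> \<alpha> ^ n" for n
        using \<alpha> w_bounds[of n] mult_left_mono[OF w_bounds(2)[of n], of "\<alpha> ^ n"] by (simp add: abs_mult)
    qed (use \<alpha> in simp)
  qed
  let ?L = "{n. p_coeff \<alpha> a t n < 2}" and ?R = "{n. 2 \<le> p_coeff \<alpha> a t n}"
  have UN: "?L \<union> ?R = UNIV" by auto
  have "tail_bound \<beta> \<alpha> a t = (1 - \<alpha>) * ((\<Sum>\<^sub>\<infinity>n\<in>?L. \<alpha> ^ n * w n) + (\<Sum>\<^sub>\<infinity>n\<in>?R. \<alpha> ^ n * w n))"
    unfolding tail_bound_def
    by (intro arg_cong2[where f = "(*)"] arg_cong2[where f = "(+)"] infsum_cong) (simp_all add: w)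
  also have "(\<Sum>\<^sub>\<infinity>n\<in>?L. \<alpha> ^ n * w n) + (\<Sum>\<^sub>\<infinity>n\<in>?R. \<alpha> ^ n * w n) = (\<Sum>\<^sub>\<infinity>n\<in>?L \<union> ?R. \<alpha> ^ n * w n)"
    by (intro infsum_Un_disjoint[symmetric] summable_on_subset_banach[OF summ]) auto
  finally have "tail_bound \<beta> \<alpha> a t = (1 - \<alpha>) * (\<Sum>\<^sub>\<infinity>n. \<alpha> ^ n * w n)"
    by (simp only: UN)
  moreover have "(\<lambda>n. \<alpha> ^ n * w n) sums (\<Sum>\<^sub>\<infinity>n. \<alpha> ^ n * w n)"
    using has_sum_imp_sums[OF has_sum_infsum[OF summ]] .
  ultimately show ?thesis
    using sums_mult[of "\<lambda>n. \<alpha> ^ n * w n" _ "1 - \<alpha>"] by (simp add: mult.assoc)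
qed

context bernoulli_exponential
begin

definition tail_weight :: "(nat \<Rightarrow> real) \<Rightarrow> real \<Rightarrow> nat \<Rightarrow> real" where
  "tail_weight a t n = (if p_coeff \<alpha> a t n < 2 then 1 else exp_ereal (- p_coeff \<alpha> a t n))"

lemma tail_weight_pos:
  fixes t :: real
  assumes "0 < a n"
  defines "p \<equiv> (t - later_mean a n) / a n"
  shows "tail_weight a t n = (if p < 2 then 1 else exp (- p))" and "t = p * a n + later_mean a n"
  using assms by (auto simp: tail_weight_def p_coeff_def later_mean_def exp_ereal_def)

lemma tail_weight_zero: "a n = 0 \<Longrightarrow> tail_weight a t n = 0"
  by (simp add: tail_weight_def p_coeff_def exp_ereal_def)

lemma tail_weight_bounds:
  assumes "0 \<le> a n"
  shows "0 \<le> tail_weight a t n" "tail_weight a t n \<le> 1"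
  using tail_weight_pos(1)[of a n t] tail_weight_zero[of a n t] assms by (cases "a n = 0"; simp)+

lemma tail_weight_estimates:
  assumes a: "antimono a" "\<And>k. 0 \<le> a k" "summable a" and t: "0 < t"
  shows "prob {\<omega> \<in> space M. 4 * t \<le> a n * \<theta> n \<omega> + later_sum a n \<omega>} \<le> tail_weight a t n"
    and "exp (- 1) * tail_weight a t n \<le> prob {\<omega> \<in> space M. t / 6 \<le> a n * \<theta> n \<omega> + later_sum a n \<omega>}"
proof -
  let ?T = "\<lambda>\<omega>. a n * \<theta> n \<omega> + later_sum a n \<omega>"
  have "prob {\<omega> \<in> space M. 4 * t \<le> ?T \<omega>} \<le> tail_weight a t n
      \<and> exp (- 1) * tail_weight a t n \<le> prob {\<omega> \<in> space M. t / 6 \<le> ?T \<omega>}"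
  proof (cases "a n = 0")
    case True
    then have "a (Suc n + k) = 0" for k
      using later_weights(2)[OF a, of n k] a(2)[of "Suc n + k"] by simp
    then have "?T \<omega> = 0" for \<omega>
      using True by (simp add: later_sum_def)
    then show ?thesis
      using t True by (simp add: tail_weight_zero)
  next
    case False
    then have an: "0 < a n" using a(2)[of n] by simp
    show ?thesis
      using prob_tail_upper[OF a an tail_weight_pos(2)[where a = a and t = t, OF an]] prob_tail_lower[OF a an tail_weight_pos(2)[where a = a and t = t, OF an]]
        prob_le_1
      unfolding tail_weight_pos(1)[where a = a and t = t, OF an] by (auto simp: not_less)
  qed
  then show "prob {\<omega> \<in> space M. 4 * t \<le> ?T \<omega>} \<le> tail_weight a t n"
    and "exp (- 1) * tail_weight a t n \<le> prob {\<omega> \<in> space M. t / 6 \<le> ?T \<omega>}" by blast+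
qed

lemma tail_bound_estimates:
  assumes \<alpha>: "\<alpha> < 1" and a: "antimono a" "\<And>k. 0 \<le> a k" "summable a" and t: "0 < t"
  shows "prob {\<omega> \<in> space M. 4 * t \<le> (\<Sum>n. a n * \<kappa> n \<omega> * \<theta> n \<omega>)} \<le> tail_bound 1 \<alpha> a t"
    and "exp (- 1) * tail_bound 1 \<alpha> a t \<le> prob {\<omega> \<in> space M. t / 6 \<le> (\<Sum>n. a n * \<kappa> n \<omega> * \<theta> n \<omega>)}"
proof -
  have bound: "(\<lambda>n. (1 - \<alpha>) * \<alpha> ^ n * tail_weight a t n) sums tail_bound 1 \<alpha> a t"
  proof (rule tail_bound_sums)
    have "ereal (- 1) * x = - x" for x by (cases x) auto
    then show "tail_weight a t n = exp_ereal (ereal (- 1) * p_coeff \<alpha> a t n)" if "2 \<le> p_coeff \<alpha> a t n" for n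
      using that by (simp add: tail_weight_def not_less[symmetric])
    show "tail_weight a t n = 1" if "p_coeff \<alpha> a t n < 2" for n
      using that by (simp add: tail_weight_def)
  qed (use \<alpha> \<alpha>_bounds a(2) in \<open>simp_all add: tail_weight_bounds\<close>)
  have q: "0 \<le> (1 - \<alpha>) * \<alpha> ^ n" for n
    using \<alpha>_bounds by simp
  have "0 < 4 * t" "0 < t / 6" using t by auto
  note upper = first_success_decomposition[OF a(2,3) this(1)]
    and lower = first_success_decomposition[OF a(2,3) this(2)]
  show "prob {\<omega> \<in> space M. 4 * t \<le> (\<Sum>n. a n * \<kappa> n \<omega> * \<theta> n \<omega>)} \<le> tail_bound 1 \<alpha> a t"
    by (rule sums_le[OF _ upper bound]) (intro mult_left_mono tail_weight_estimates(1)[OF a t] q)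
  show "exp (- 1) * tail_bound 1 \<alpha> a t \<le> prob {\<omega> \<in> space M. t / 6 \<le> (\<Sum>n. a n * \<kappa> n \<omega> * \<theta> n \<omega>)}"
  proof (rule sums_le[OF _ sums_mult[OF bound] lower])
    show "exp (- 1) * ((1 - \<alpha>) * \<alpha> ^ n * tail_weight a t n)
        \<le> (1 - \<alpha>) * \<alpha> ^ n * prob {\<omega> \<in> space M. t / 6 \<le> a n * \<theta> n \<omega> + later_sum a n \<omega>}" for n
      using mult_left_mono[OF tail_weight_estimates(2)[OF a t, of n] q[of n]] by (simp only: mult_ac)
  qed
qed

end

text \<open>The constants do not depend on the sample space, so one choice serves every type.\<close>
lemma tail_constants_explicit: "tail_constants TYPE('w) 1 4 (1 / 6) (exp (- 1))"
  unfolding tail_constants_def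
proof (intro conjI allI impI)
  fix \<alpha> t :: real and M :: "'w measure" and \<kappa> \<theta> :: "nat \<Rightarrow> 'w \<Rightarrow> real" and a :: "nat \<Rightarrow> real"
  assume H: "0 \<le> \<alpha> \<and> \<alpha> < 1 \<and> bernoulli_exponential M \<alpha> \<kappa> \<theta> \<and> antimono a \<and> (\<forall>n. 0 \<le> a n) \<and> summable a \<and> 0 < t"
  then interpret bernoulli_exponential M \<alpha> \<kappa> \<theta> by simp
  show "prob {\<omega> \<in> space M. 4 * t \<le> (\<Sum>n. a n * \<kappa> n \<omega> * \<theta> n \<omega>)} \<le> tail_bound 1 \<alpha> a t"
    and "exp (- 1) * tail_bound 1 \<alpha> a t \<le> prob {\<omega> \<in> space M. 1 / 6 * t \<le> (\<Sum>n. a n * \<kappa> n \<omega> * \<theta> n \<omega>)}"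
    using tail_bound_estimates[of a t] H by simp_all
qed simp_all

section \<open>Transfer between sample spaces\<close>

text \<open>Independence and marginal laws are properties of the joint law, so they pass to an image measure.\<close>
lemma bernoulli_exponential_distr:
  fixes M :: "'a measure" and G :: "'a \<Rightarrow> 'b"
  assumes G: "G \<in> M \<rightarrow>\<^sub>M N"
    and \<kappa>: "\<And>n. \<kappa> n \<in> borel_measurable N" and \<theta>: "\<And>n. \<theta> n \<in> borel_measurable N"
    and BE: "bernoulli_exponential M \<alpha> (\<lambda>n \<omega>. \<kappa> n (G \<omega>)) (\<lambda>n \<omega>. \<theta> n (G \<omega>))"
  shows "bernoulli_exponential (distr M N G) \<alpha> \<kappa> \<theta>"
proof -
  interpret bernoulli_exponential M \<alpha> "\<lambda>n \<omega>. \<kappa> n (G \<omega>)" "\<lambda>n \<omega>. \<theta> n (G \<omega>)" by (rule BE)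
  interpret D: prob_space "distr M N G" by (rule prob_space_distr[OF G])
  have indep: "D.indep_vars (\<lambda>_. borel) X UNIV"
    if X: "\<And>n. X n \<in> borel_measurable N" and ind: "indep_vars (\<lambda>_. borel) (\<lambda>n \<omega>. X n (G \<omega>)) UNIV"
    for X :: "nat \<Rightarrow> 'b \<Rightarrow> real"
  proof -
    have XG: "random_variable borel (\<lambda>\<omega>. X n (G \<omega>))" for n
      using G X by measurable
    have "distr M (Pi\<^sub>M UNIV (\<lambda>_. borel)) (\<lambda>\<omega>. \<lambda>n\<in>UNIV. X n (G \<omega>))
        = Pi\<^sub>M UNIV (\<lambda>n. distr M borel (\<lambda>\<omega>. X n (G \<omega>)))"
      using ind by (subst (asm) indep_vars_iff_distr_eq_PiM) (simp_all add: XG)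
    moreover have "(\<lambda>x. \<lambda>n\<in>UNIV. X n x) \<in> N \<rightarrow>\<^sub>M Pi\<^sub>M UNIV (\<lambda>_. borel)"
      by (intro measurable_restrict X)
    ultimately show ?thesis
      using X by (subst D.indep_vars_iff_distr_eq_PiM) (simp_all add: distr_distr[OF _ G] comp_def)
  qed
  have prob_eq: "measure (distr M N G) {x \<in> space (distr M N G). \<kappa> n x = c}
      = prob {\<omega> \<in> space M. \<kappa> n (G \<omega>) = c}" for n c
  proof -
    have "{x \<in> space N. \<kappa> n x = c} \<in> sets N"
      using \<kappa>[of n] by measurable
    moreover have "G -` {x \<in> space N. \<kappa> n x = c} \<inter> space M = {\<omega> \<in> space M. \<kappa> n (G \<omega>) = c}"
      using measurable_space[OF G] by auto
    ultimately show ?thesis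
      by (simp add: measure_distr[OF G])
  qed
  have vec: "(\<lambda>x n. X n x) \<in> N \<rightarrow>\<^sub>M Pi\<^sub>M UNIV (\<lambda>_. borel)"
    if "\<And>n. X n \<in> borel_measurable N" for X :: "nat \<Rightarrow> 'b \<Rightarrow> real"
    using measurable_restrict[of UNIV X N "\<lambda>_. borel", OF that] by (simp add: restrict_def)
  show ?thesis
  proof
    show "D.indep_vars (\<lambda>_. borel) \<kappa> UNIV" "D.indep_vars (\<lambda>_. borel) \<theta> UNIV"
      by (intro indep \<kappa> \<theta> indep_\<kappa> indep_\<theta>)+
    show "D.indep_var (Pi\<^sub>M UNIV (\<lambda>_. borel)) (\<lambda>\<omega> n. \<kappa> n \<omega>) (Pi\<^sub>M UNIV (\<lambda>_. borel)) (\<lambda>\<omega> n. \<theta> n \<omega>)"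
      using indep_\<kappa>_\<theta> vec[OF \<kappa>] vec[OF \<theta>] unfolding indep_var_distribution_eq D.indep_var_distribution_eq
      by (simp add: distr_distr[OF _ G] comp_def)
    show "D.prob {\<omega> \<in> space (distr M N G). \<kappa> n \<omega> = 0} = \<alpha>" for n
      using \<kappa>_0[of n] by (simp only: prob_eq)
    show "D.prob {\<omega> \<in> space (distr M N G). \<kappa> n \<omega> = 1} = 1 - \<alpha>" for n
      using \<kappa>_1[of n] by (simp only: prob_eq)
    show "distributed (distr M N G) lborel (\<theta> n) (exponential_density 1)" for n
      using \<theta>_exponential[of n] \<theta>[of n]
      by (simp add: distributed_def distr_distr[OF _ G] comp_def)
  qed
qed

text \<open>The pair of sequences \<open>(\<kappa>, \<theta>)\<close> pushes any model to a model on the sequence space with the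
  same law, hence with the same tail probabilities.\<close>
lemma tail_constants_transfer:
  assumes TC: "tail_constants TYPE(nat \<Rightarrow> real \<times> real) \<beta> \<gamma>\<^sub>7 \<gamma>\<^sub>8 \<gamma>\<^sub>9"
  shows "tail_constants TYPE('w) \<beta> \<gamma>\<^sub>7 \<gamma>\<^sub>8 \<gamma>\<^sub>9"
  unfolding tail_constants_def
proof (intro conjI allI impI)
  show "1 \<le> \<beta>" "0 < \<gamma>\<^sub>7" "0 < \<gamma>\<^sub>8" "0 < \<gamma>\<^sub>9"
    using TC by (auto simp: tail_constants_def)
next
  fix \<alpha> t :: real and M :: "'w measure" and \<kappa> \<theta> :: "nat \<Rightarrow> 'w \<Rightarrow> real" and a :: "nat \<Rightarrow> real"
  assume H: "0 \<le> \<alpha> \<and> \<alpha> < 1 \<and> bernoulli_exponential M \<alpha> \<kappa> \<theta> \<and> antimono a \<and> (\<forall>n. 0 \<le> a n) \<and> summable a \<and> 0 < t"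
  then interpret bernoulli_exponential M \<alpha> \<kappa> \<theta> by simp
  let ?N = "Pi\<^sub>M UNIV (\<lambda>_. borel) :: (nat \<Rightarrow> real \<times> real) measure"
  define G where "G \<omega> n = (\<kappa> n \<omega>, \<theta> n \<omega>)" for \<omega> n
  have G: "G \<in> M \<rightarrow>\<^sub>M ?N"
  proof -
    have "(\<lambda>\<omega>. (\<kappa> n \<omega>, \<theta> n \<omega>)) \<in> borel_measurable M" for n by measurable
    from measurable_restrict[of UNIV "\<lambda>n \<omega>. (\<kappa> n \<omega>, \<theta> n \<omega>)" M "\<lambda>_. borel", OF this]
    show ?thesis by (simp add: G_def[abs_def] restrict_def)
  qed
  define K T where "K n x = fst (x n)" and "T n x = snd (x n)" for n and x :: "nat \<Rightarrow> real \<times> real"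
  have coord: "(\<lambda>x. x n) \<in> ?N \<rightarrow>\<^sub>M (borel :: (real \<times> real) measure)" for n
    by (rule measurable_component_singleton) simp
  have K: "K n \<in> borel_measurable ?N" and T: "T n \<in> borel_measurable ?N" for n
    unfolding K_def[abs_def] T_def[abs_def] borel_prod[symmetric]
    using coord[of n] by (auto simp: borel_prod[symmetric] intro!: measurable_compose[OF _ measurable_fst] measurable_compose[OF _ measurable_snd])
  have KT: "K n (G \<omega>) = \<kappa> n \<omega>" "T n (G \<omega>) = \<theta> n \<omega>" for n \<omega>
    by (simp_all add: K_def T_def G_def)
  have BE: "bernoulli_exponential (distr M ?N G) \<alpha> K T"
    by (rule bernoulli_exponential_distr[OF G K T]) (simp add: KT bernoulli_exponential_axioms)
  have eq: "measure (distr M ?N G) {x \<in> space (distr M ?N G). c \<le> (\<Sum>n. a n * K n x * T n x)}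
      = prob {\<omega> \<in> space M. c \<le> (\<Sum>n. a n * \<kappa> n \<omega> * \<theta> n \<omega>)}" for c
  proof -
    note [measurable] = K T
    have "{x \<in> space ?N. c \<le> (\<Sum>n. a n * K n x * T n x)} \<in> sets ?N" by measurable
    moreover have "G -` {x \<in> space ?N. c \<le> (\<Sum>n. a n * K n x * T n x)} \<inter> space M
        = {\<omega> \<in> space M. c \<le> (\<Sum>n. a n * \<kappa> n \<omega> * \<theta> n \<omega>)}"
      using measurable_space[OF G] by (auto simp: KT)
    ultimately show ?thesis by (simp add: measure_distr[OF G])
  qed
  from TC H BE have
    "measure (distr M ?N G) {x \<in> space (distr M ?N G). \<gamma>\<^sub>7 * t \<le> (\<Sum>n. a n * K n x * T n x)} \<le> tail_bound \<beta> \<alpha> a t"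
    "\<gamma>\<^sub>9 * tail_bound \<beta> \<alpha> a t \<le> measure (distr M ?N G) {x \<in> space (distr M ?N G). \<gamma>\<^sub>8 * t \<le> (\<Sum>n. a n * K n x * T n x)}"
    unfolding tail_constants_def by blast+
  then show "prob {\<omega> \<in> space M. \<gamma>\<^sub>7 * t \<le> (\<Sum>n. a n * \<kappa> n \<omega> * \<theta> n \<omega>)} \<le> tail_bound \<beta> \<alpha> a t"
    "\<gamma>\<^sub>9 * tail_bound \<beta> \<alpha> a t \<le> prob {\<omega> \<in> space M. \<gamma>\<^sub>8 * t \<le> (\<Sum>n. a n * \<kappa> n \<omega> * \<theta> n \<omega>)}"
    by (simp_all only: eq)
qed

theorem proposition2p8:
  "(\<exists>\<beta> \<gamma>\<^sub>7 \<gamma>\<^sub>8 \<gamma>\<^sub>9. tail_constants TYPE(nat \<Rightarrow> real \<times> real) \<beta> \<gamma>\<^sub>7 \<gamma>\<^sub>8 \<gamma>\<^sub>9) \<and>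
   (\<forall>\<beta> \<gamma>\<^sub>7 \<gamma>\<^sub>8 \<gamma>\<^sub>9. tail_constants TYPE(nat \<Rightarrow> real \<times> real) \<beta> \<gamma>\<^sub>7 \<gamma>\<^sub>8 \<gamma>\<^sub>9 \<longrightarrow>
                  tail_constants TYPE('w) \<beta> \<gamma>\<^sub>7 \<gamma>\<^sub>8 \<gamma>\<^sub>9)"
proof (intro conjI allI impI)
  show "\<exists>\<beta> \<gamma>\<^sub>7 \<gamma>\<^sub>8 \<gamma>\<^sub>9. tail_constants TYPE(nat \<Rightarrow> real \<times> real) \<beta> \<gamma>\<^sub>7 \<gamma>\<^sub>8 \<gamma>\<^sub>9"
    by (intro exI) (rule tail_constants_explicit)
qed (rule tail_constants_transfer)

end
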